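(* Let $1\le p<n$ be integers and let $(x_1,y_1),\dots,(x_n,y_n)$ be i.i.d. random pairs in $\mathbb{R}^p\times\{-1,+1\}$ with $x_j\sim\mathcal{N}(0,I_p)$. (1) Under the sign-flip noise model with parameter $\delta\ge1/2$, the probabilities of linear separability without, respectively with, intercept satisfy $$ S(n,p)\le2\,\delta^n\sum_{j=0}^{p-1}\binom{n-1}{j},\qquad S_0(n,p)\le2\,\delta^n\sum_{j=0}^{p}\binom{n-1}{j}. $$ (2) Under the signal-less imbalanced model with parameter $b\ge1/2$, the probability of linear separability with intercept satisfies $$ S_0(n,p)\le2\,b^n\sum_{j=0}^{p}\binom{n-1}{j}. $$
   Context: $S(n,p):=\mathbb{P}\big[\bigcup_{\beta\in\mathbb{R}^p}\bigcap_{j=1}^n\{y_jx_j^T\beta>0\}\big]$ and $S_0(n,p):=\mathbb{P}\big[\bigcup_{(\beta_0,\beta)\in\mathbb{R}^{p+1}}\bigcap_{j=1}^n\{y_j(\beta_0+x_j^T\beta)>0\}\big]$ are the probabilities of linear separability without and with intercept. Sign-flip noise model with parameter $\delta$: for some fixed $(\beta_0^*,\beta^* )\in\mathbb{R}\times S^{p-1}$ (with $S^{p-1}$ the Euclidean unit sphere; the version of the model without intercept is $\beta_0^*=0$), $\mathbb{P}[y_j=1\mid x_j]=\delta$ if $\beta_0^*+x_j^T\beta^*>0$ and $\mathbb{P}[y_j=1\mid x_j]=1-\delta$ if $\beta_0^*+x_j^T\beta^*\le0$. Signal-less imbalanced model with parameter $b$: $y_j$ is independent of $x_j$ and $\mathbb{P}[y_j=1]=b$.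 *)

theory Defs
  imports "HOL-Probability.Probability"
begin

definition std_gaussian_density :: "real ^ 'p \<Rightarrow> real" where
  "std_gaussian_density v = exp (- (norm v)\<^sup>2 / 2) / sqrt (2 * pi) ^ CARD('p)"

text \<open>Labels are real numbers in \<open>{-1, 1}\<close>, so that they can multiply the linear scores.
  The dimension \<open>p\<close> is \<open>CARD('p)\<close>, which is automatically at least 1.
  Measurability of the pairs is part of \<open>indep_vars\<close>.\<close>

locale gaussian_labelled_sample = prob_space M
  for M :: "'w measure" +
  fixes n :: nat
    and x :: "nat \<Rightarrow> 'w \<Rightarrow> real ^ 'p"
    and y :: "nat \<Rightarrow> 'w \<Rightarrow> real"
  assumes independent: "indep_vars (\<lambda>_. borel) (\<lambda>j \<omega>. (x j \<omega>, y j \<omega>)) {1..n}"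
    and identically_distributed:
      "\<And>i j. \<lbrakk>i \<in> {1..n}; j \<in> {1..n}\<rbrakk> \<Longrightarrow>
        distr M borel (\<lambda>\<omega>. (x i \<omega>, y i \<omega>)) = distr M borel (\<lambda>\<omega>. (x j \<omega>, y j \<omega>))"
    and labels: "\<And>j \<omega>. \<lbrakk>j \<in> {1..n}; \<omega> \<in> space M\<rbrakk> \<Longrightarrow> y j \<omega> \<in> {-1, 1}"
    and gaussian: "\<And>j. j \<in> {1..n} \<Longrightarrow> distributed M lborel (x j) std_gaussian_density"

text \<open>The conditional probability given \<open>x j\<close> is the conditional expectation of the
  indicator of \<open>y j = 1\<close> with respect to the \<open>\<sigma>\<close>-algebra generated by \<open>x j\<close>.\<close>

locale sign_flip_model = gaussian_labelled_sample M n x y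
  for M :: "'w measure" and n :: nat
    and x :: "nat \<Rightarrow> 'w \<Rightarrow> real ^ 'p" and y :: "nat \<Rightarrow> 'w \<Rightarrow> real" +
  fixes \<delta> :: real and \<beta>0 :: real and \<beta> :: "real ^ 'p"
  assumes unit_signal: "\<beta> \<in> sphere 0 1"
    and sign_flip: "\<And>j. j \<in> {1..n} \<Longrightarrow>
      AE \<omega> in M. real_cond_exp M (vimage_algebra (space M) (x j) borel)
          (indicat_real {\<omega> \<in> space M. y j \<omega> = 1}) \<omega>
        = (if \<beta>0 + x j \<omega> \<bullet> \<beta> > 0 then \<delta> else 1 - \<delta>)"

text \<open>\<open>indep_var\<close> needs two variables of the same type, so independence of the vector
  \<open>x j\<close> and the scalar \<open>y j\<close> is stated for their generated \<open>\<sigma>\<close>-algebras.\<close>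

locale signalless_imbalanced_model = gaussian_labelled_sample M n x y
  for M :: "'w measure" and n :: nat
    and x :: "nat \<Rightarrow> 'w \<Rightarrow> real ^ 'p" and y :: "nat \<Rightarrow> 'w \<Rightarrow> real" +
  fixes b :: real
  assumes label_indep: "\<And>j. j \<in> {1..n} \<Longrightarrow>
      indep_set (sets (vimage_algebra (space M) (x j) borel))
        (sets (vimage_algebra (space M) (y j) borel))"
    and label_prob: "\<And>j. j \<in> {1..n} \<Longrightarrow> prob {\<omega> \<in> space M. y j \<omega> = 1} = b"

definition separability_prob ::
    "'w measure \<Rightarrow> nat \<Rightarrow> (nat \<Rightarrow> 'w \<Rightarrow> real ^ 'p) \<Rightarrow> (nat \<Rightarrow> 'w \<Rightarrow> real) \<Rightarrow> real" where
  "separability_prob M n x y =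
     measure M {\<omega> \<in> space M. \<exists>\<beta>. \<forall>j\<in>{1..n}. y j \<omega> * (x j \<omega> \<bullet> \<beta>) > 0}"

definition separability_prob_intercept ::
    "'w measure \<Rightarrow> nat \<Rightarrow> (nat \<Rightarrow> 'w \<Rightarrow> real ^ 'p) \<Rightarrow> (nat \<Rightarrow> 'w \<Rightarrow> real) \<Rightarrow> real" where
  "separability_prob_intercept M n x y =
     measure M {\<omega> \<in> space M. \<exists>\<beta>0 \<beta>. \<forall>j\<in>{1..n}. y j \<omega> * (\<beta>0 + x j \<omega> \<bullet> \<beta>) > 0}"

end

theory Submission imports Defs begin

text \<open>Conditionally on the features, the labels are independent and each takes a given value with
  probability at most \<open>\<delta>\<close> (respectively \<open>b\<close>), so every fixed sign vector occurs with conditional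
  probability at most \<open>\<delta>\<^sup>n\<close>. By Cover's function counting theorem, \<open>n\<close> points of a
  \<open>d\<close>-dimensional space admit at most \<open>2 * (\<Sum>j<d. (n - 1) choose j)\<close> linearly separable sign
  vectors; for the upper bound no general position is needed. The intercept is absorbed by the lifting \<open>v \<mapsto> (1, v)\<close>. Conditional densities are avoided: one label at
  a time is integrated out of the product law of the sample.\<close>

section \<open>Cover's function counting bound\<close>

text \<open>The weight vector ranges over a subspace \<open>V\<close>, because deleting a point
  leads from the whole space to hyperplane sections of it. Patterns are extensional on
  \<open>I\<close>, so there are finitely many, and \<open>restrict\<close> maps patterns to
  patterns.\<close>

definition sign_patterns :: "'i set \<Rightarrow> ('i \<Rightarrow> 'a::euclidean_space) \<Rightarrow> 'a set \<Rightarrow> ('i \<Rightarrow> real) set" where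
  "sign_patterns I w V = {s \<in> I \<rightarrow>\<^sub>E {-1, 1}. \<exists>\<beta>\<in>V. \<forall>i\<in>I. s i * (w i \<bullet> \<beta>) > 0}"

lemma finite_sign_patterns: "finite I \<Longrightarrow> finite (sign_patterns I w V)"
  unfolding sign_patterns_def by (simp add: finite_PiE)

lemma sign_patterns_restrict:
  assumes "s \<in> sign_patterns (insert i I) w V" "i \<notin> I"
  shows "restrict s I \<in> sign_patterns I w V"
  using assms unfolding sign_patterns_def by (fastforce simp: PiE_iff extensional_def)

text \<open>Witnesses of the two extensions lie strictly on opposite sides of the hyperplane
  orthogonal to \<open>w i\<close>, so some positive combination of them lies on it. The strict
  inequalities on \<open>I\<close> have the same signs for both witnesses and survive positive
  combinations.\<close>

lemma sign_patterns_orthogonal: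
  assumes "subspace V" "i \<notin> I"
    and s: "s \<in> sign_patterns (insert i I) w V" "s i = 1"
    and t: "t \<in> sign_patterns (insert i I) w V" "t i = -1"
    and eq: "restrict s I = restrict t I"
  shows "restrict s I \<in> sign_patterns I w (V \<inter> {\<beta>. w i \<bullet> \<beta> = 0})"
proof -
  from s obtain u where u: "u \<in> V" "w i \<bullet> u > 0" "\<And>j. j \<in> I \<Longrightarrow> s j * (w j \<bullet> u) > 0"
    unfolding sign_patterns_def by auto
  from t obtain v where v: "v \<in> V" "w i \<bullet> v < 0" "\<And>j. j \<in> I \<Longrightarrow> t j * (w j \<bullet> v) > 0"
    unfolding sign_patterns_def by auto
  have st: "s j = t j" if "j \<in> I" for j
    using fun_cong[OF eq, of j] that by simp
  \<comment> \<open>Both weights are positive, since \<open>v\<close> is on the negative side of the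
    hyperplane and \<open>u\<close> on the positive side; they are chosen so that the inner products
    with \<open>w i\<close> cancel.\<close>
  define \<beta> where "\<beta> = (- (w i \<bullet> v)) *\<^sub>R u + (w i \<bullet> u) *\<^sub>R v"
  have "\<beta> \<in> V"
    unfolding \<beta>_def using assms(1) u v by (intro subspace_add subspace_scale)
  moreover have "w i \<bullet> \<beta> = 0"
    by (simp add: \<beta>_def inner_add_right inner_diff_right)
  moreover have "s j * (w j \<bullet> \<beta>) > 0" if "j \<in> I" for j
  proof -
    have "s j * (w j \<bullet> \<beta>) = (- (w i \<bullet> v)) * (s j * (w j \<bullet> u)) + (w i \<bullet> u) * (t j * (w j \<bullet> v))"
      using st[OF that] by (simp add: \<beta>_def inner_add_right algebra_simps)
    also have "\<dots> > 0"
      using u(2) v(2) u(3)[OF that] v(3)[OF that]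
      by (intro add_pos_pos mult_pos_pos[of "_ \<bullet> _"] mult_pos_pos[of "- _"]) auto
    finally show ?thesis .
  qed
  moreover have "restrict s I \<in> I \<rightarrow>\<^sub>E {-1, 1}"
    using s assms(2) unfolding sign_patterns_def by (auto simp: PiE_iff)
  ultimately show ?thesis
    unfolding sign_patterns_def by auto
qed

text \<open>A pattern on \<open>I\<close> extends to both signs at \<open>i\<close> only if it is realised by some \<open>\<beta>\<close>
  orthogonal to \<open>w i\<close>.\<close>

lemma card_sign_patterns_insert:
  assumes "finite I" "i \<notin> I" "subspace V"
  shows "card (sign_patterns (insert i I) w V)
    \<le> card (sign_patterns I w V) + card (sign_patterns I w (V \<inter> {\<beta>. w i \<bullet> \<beta> = 0}))"
proof -
  let ?r = "\<lambda>s. restrict s I"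
  define A where "A c = {s \<in> sign_patterns (insert i I) w V. s i = c}" for c :: real
  have split: "sign_patterns (insert i I) w V = A 1 \<union> A (-1)"
    unfolding A_def sign_patterns_def by (auto simp: PiE_iff)
  have fin: "finite (A c)" for c
    unfolding A_def by (rule finite_Collect_conjI) (simp add: finite_sign_patterns assms(1))
  \<comment> \<open>Once the sign at \<open>i\<close> is fixed, restriction to \<open>I\<close>
    loses no information.\<close>
  have inj: "inj_on ?r (A c)" for c
  proof (rule inj_onI)
    fix s t assume *: "s \<in> A c" "t \<in> A c" "?r s = ?r t"
    show "s = t"
    proof (rule PiE_ext)
      show "s \<in> insert i I \<rightarrow>\<^sub>E {-1, 1}" "t \<in> insert i I \<rightarrow>\<^sub>E {-1, 1}"
        using * unfolding A_def sign_patterns_def by auto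
      show "s j = t j" if "j \<in> insert i I" for j
      proof (cases "j = i")
        case True
        then show ?thesis using *(1,2) by (simp add: A_def)
      next
        case False
        then show ?thesis using fun_cong[OF *(3), of j] that by simp
      qed
    qed
  qed
  have "card (sign_patterns (insert i I) w V) \<le> card (A 1) + card (A (-1))"
    unfolding split by (rule card_Un_le)
  also have "\<dots> = card (?r ` A 1) + card (?r ` A (-1))"
    by (simp add: card_image inj)
  \<comment> \<open>Inclusion-exclusion: the union consists of the patterns on \<open>I\<close> that
    extend to \<open>i\<close> at all, the intersection of those that extend with both
    signs.\<close>
  also have "\<dots> = card (?r ` A 1 \<union> ?r ` A (-1)) + card (?r ` A 1 \<inter> ?r ` A (-1))"
    by (rule card_Un_Int) (simp_all add: fin)
  also have "\<dots> \<le> card (sign_patterns I w V) + card (sign_patterns I w (V \<inter> {\<beta>. w i \<bullet> \<beta> = 0}))"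
  proof (rule add_mono; rule card_mono[OF finite_sign_patterns[OF assms(1)]])
    show "?r ` A 1 \<union> ?r ` A (-1) \<subseteq> sign_patterns I w V"
      by (auto simp: A_def intro: sign_patterns_restrict[OF _ assms(2)])
    show "?r ` A 1 \<inter> ?r ` A (-1) \<subseteq> sign_patterns I w (V \<inter> {\<beta>. w i \<bullet> \<beta> = 0})"
    proof (intro subsetI, elim IntE imageE)
      fix u s t assume "u = ?r s" "s \<in> A 1" "u = ?r t" "t \<in> A (-1)"
      then show "u \<in> sign_patterns I w (V \<inter> {\<beta>. w i \<bullet> \<beta> = 0})"
        using sign_patterns_orthogonal[OF assms(3,2), of s w t] by (simp add: A_def)
    qed
  qed
  finally show ?thesis .
qed

text \<open>Pascal's rule, summed. It matches the recursion of the count: deleting a point keeps the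
  dimension in one term and lowers it by one in the other.\<close>

lemma sum_binomial_Suc_lessThan:
  "(\<Sum>j<d. Suc m choose j) = (\<Sum>j<d. m choose j) + (\<Sum>j<d - 1. m choose j)"
proof (cases d)
  case (Suc k)
  show ?thesis
    unfolding Suc by (simp only: sum.lessThan_Suc_shift) (simp add: sum.distrib)
qed simp

lemma card_sign_patterns_le:
  fixes w :: "'i \<Rightarrow> 'a::euclidean_space"
  assumes "finite I" "I \<noteq> {}" "subspace V"
  shows "card (sign_patterns I w V) \<le> 2 * (\<Sum>j<dim V. (card I - 1) choose j)"
proof -
  \<comment> \<open>The dimension is replaced by an upper bound \<open>d\<close>, and
    \<open>V\<close> is generalised, so that the induction hypothesis applies to the hyperplane
    section with bound \<open>d - 1\<close> and no monotonicity argument in the dimension is called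
    for.\<close>
  have "card (sign_patterns I w V) \<le> 2 * (\<Sum>j<d. (card I - 1) choose j)"
    if "subspace V" "dim V \<le> d" for V d
    using assms(1,2) that
  proof (induction I arbitrary: V d rule: finite_ne_induct)
    case (singleton i)
    show ?case
    proof (cases "d = 0")
      case True
      then have "V \<subseteq> {0}" using singleton by simp
      then have "sign_patterns {i} w V = {}" unfolding sign_patterns_def by auto
      then show ?thesis by simp
    next
      case False
      then obtain k where d: "d = Suc k" by (cases d) auto
      have "card (sign_patterns {i} w V) \<le> card ({i} \<rightarrow>\<^sub>E {-1, 1::real})"
        unfolding sign_patterns_def by (rule card_mono) (auto intro: finite_PiE)
      also have "\<dots> = 2" by (subst card_PiE) auto
      \<comment> \<open>The upper index is 0, so only \<open>j = 0\<close> contributes and the sum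
        is 1.\<close>
      also have "\<dots> \<le> 2 * (\<Sum>j<d. (card {i} - 1) choose j)"
        unfolding d by (simp add: sum.lessThan_Suc_shift del: sum.lessThan_Suc)
      finally show ?thesis .
    qed
  next
    case (insert i I)
    let ?W = "V \<inter> {\<beta>. w i \<bullet> \<beta> = 0}"
    show ?case
    \<comment> \<open>If every vector of \<open>V\<close> is orthogonal to \<open>w i\<close>, no
      strict sign at \<open>i\<close> can be realised. Otherwise the section \<open>?W\<close> is a
      proper subspace and its dimension drops.\<close>
    proof (cases "V \<subseteq> {\<beta>. w i \<bullet> \<beta> = 0}")
      case True
      then have "sign_patterns (insert i I) w V = {}" unfolding sign_patterns_def by auto
      then show ?thesis by simp
    next
      case False
      have W: "subspace ?W"
        using insert.prems(1) by (intro subspace_inter subspace_hyperplane)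
      have "span ?W \<subset> span V"
        using False W insert.prems(1) span_eq_iff by (metis Int_lower1 inf.absorb_iff1 psubsetI)
      then have dimW: "dim ?W \<le> d - 1"
        using dim_psubset[of ?W V] insert.prems(2) by linarith
      obtain m where m: "card I = Suc m"
        using insert.hyps by (metis card_0_eq not0_implies_Suc)
      have "card (sign_patterns (insert i I) w V) \<le> card (sign_patterns I w V) + card (sign_patterns I w ?W)"
        using insert by (intro card_sign_patterns_insert) auto
      also have "\<dots> \<le> 2 * (\<Sum>j<d. m choose j) + 2 * (\<Sum>j<d - 1. m choose j)"
        using insert.IH[OF insert.prems] insert.IH[OF W dimW] unfolding m by simp
      also have "\<dots> = 2 * (\<Sum>j<d. (card (insert i I) - 1) choose j)"
        using insert.hyps by (simp add: m sum_binomial_Suc_lessThan)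
      finally show ?thesis .
    qed
  qed
  then show ?thesis using assms(3) by blast
qed

section \<open>Integrating out the labels\<close>

text \<open>The features are kept and the labels overwritten. The restriction to \<open>I\<close>
  makes the result a point of the product space over \<open>I\<close>.\<close>

definition relabel :: "'i set \<Rightarrow> ('i \<Rightarrow> real) \<Rightarrow> ('i \<Rightarrow> 'a \<times> real) \<Rightarrow> 'i \<Rightarrow> 'a \<times> real" where
  "relabel I s z = (\<lambda>i\<in>I. (fst (z i), s i))"

text \<open>The rectangle bound says that the feature law on the event of label \<open>t\<close> is
  at most \<open>c\<close> times the whole feature law, as measures. This passes to integrals of
  nonnegative functions, and summing over the two labels gives the claim.\<close>

lemma nn_integral_relabel_le:
  fixes N :: "('a::euclidean_space \<times> real) measure" and c :: ennreal
  assumes [measurable_cong]: "sets N = sets borel"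
    and lab: "AE z in N. snd z \<in> {-1, 1}"
    and le: "\<And>B t. B \<in> sets borel \<Longrightarrow> t \<in> {-1, 1} \<Longrightarrow> emeasure N (B \<times> {t}) \<le> c * emeasure N (B \<times> UNIV)"
    and g[measurable]: "g \<in> borel_measurable borel"
  shows "(\<integral>\<^sup>+z. g z \<partial>N) \<le> c * (\<Sum>t\<in>{-1, 1}. \<integral>\<^sup>+z. g (fst z, t) \<partial>N)"
proof -
  have [measurable]: "fst \<in> borel_measurable (borel :: ('a \<times> real) measure)"
      "snd \<in> borel_measurable (borel :: ('a \<times> real) measure)"
    by (simp_all add: borel_prod[symmetric])
  have slice: "(\<integral>\<^sup>+z. h (fst z) * indicator {t} (snd z) \<partial>N) \<le> c * (\<integral>\<^sup>+z. h (fst z) \<partial>N)"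
    if [measurable]: "h \<in> borel_measurable borel" and t: "t \<in> {-1, 1}" for h t
  proof -
    \<comment> \<open>\<open>?K\<close> gives a Borel set \<open>B\<close> the mass of
      \<open>B \<times> {t}\<close>, and \<open>?L\<close> gives it \<open>c\<close> times the mass
      of \<open>B \<times> UNIV\<close>, so the rectangle bound is exactly
      \<open>?K \<le> ?L\<close>.\<close>
    let ?K = "distr (density N (\<lambda>z. indicator {t} (snd z))) borel fst"
    let ?L = "scale_measure c (distr N borel fst)"
    have "emeasure ?K B \<le> emeasure ?L B" for B
    proof (cases "B \<in> sets borel")
      case True
      have B: "fst -` B \<inter> space N = B \<times> UNIV"
        using sets_eq_imp_space_eq[OF assms(1)] by auto
      have mB: "B \<times> UNIV \<in> sets N"
        using measurable_sets[OF _ True, of fst N] B by simp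
      have mBt: "B \<times> {t} \<in> sets N"
        using True assms(1) by (auto intro!: pair_measureI simp: borel_prod[symmetric])
      have "emeasure ?K B = (\<integral>\<^sup>+z. indicator {t} (snd z) * indicator (B \<times> UNIV) z \<partial>N)"
        using True mB B by (simp add: emeasure_distr emeasure_density)
      also have "\<dots> = (\<integral>\<^sup>+z. indicator (B \<times> {t}) z \<partial>N)"
        by (intro nn_integral_cong) (auto split: split_indicator)
      also have "\<dots> = emeasure N (B \<times> {t})" using mBt by simp
      also have "\<dots> \<le> emeasure ?L B"
        using le[OF True t] True B by (simp add: emeasure_distr)
      finally show ?thesis .
    qed (simp add: emeasure_notin_sets)
    then have "?K \<le> ?L"
      by (simp add: le_measure_iff le_fun_def space_scale_measure)
    then have "(\<integral>\<^sup>+x. h x \<partial>?K) \<le> (\<integral>\<^sup>+x. h x \<partial>?L)"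
      by (intro nn_integral_mono_measure) auto
    then show ?thesis
      by (simp add: nn_integral_distr nn_integral_density nn_integral_scale_measure mult.commute)
  qed
  have gt: "(\<lambda>x. g (x, t)) \<in> borel_measurable borel" for t
    by (rule measurable_compose[OF _ g]) (simp add: borel_prod[symmetric])
  have meas: "(\<lambda>z. g (fst z, t) * indicator {t} (snd z)) \<in> borel_measurable N" for t
    by (intro borel_measurable_times_ennreal measurable_compose[of fst N borel, OF _ gt]
      measurable_compose[of snd N borel, OF _ borel_measurable_indicator]) measurable
  \<comment> \<open>Almost surely exactly one summand is nonzero, the one whose \<open>t\<close> is
    the actual label.\<close>
  have "(\<integral>\<^sup>+z. g z \<partial>N) = (\<integral>\<^sup>+z. (\<Sum>t\<in>{-1, 1}. g (fst z, t) * indicator {t} (snd z)) \<partial>N)"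
  proof (rule nn_integral_cong_AE, use lab in eventually_elim)
    fix z :: "'a \<times> real" assume "snd z \<in> {-1, 1}"
    then show "g z = (\<Sum>t\<in>{-1, 1}. g (fst z, t) * indicator {t} (snd z))"
      by (cases z) (elim insertE emptyE; subst sum.insert; simp)
  qed
  also have "\<dots> = (\<Sum>t\<in>{-1, 1}. \<integral>\<^sup>+z. g (fst z, t) * indicator {t} (snd z) \<partial>N)"
    by (rule nn_integral_sum) (rule meas)
  also have "\<dots> \<le> (\<Sum>t\<in>{-1, 1}. c * (\<integral>\<^sup>+z. g (fst z, t) \<partial>N))"
    by (intro sum_mono slice gt)
  also have "\<dots> = c * (\<Sum>t\<in>{-1, 1}. \<integral>\<^sup>+z. g (fst z, t) \<partial>N)"
    by (rule sum_distrib_left[symmetric])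
  finally show ?thesis .
qed

lemma measurable_relabel:
  assumes "\<And>i. sets (N i) = sets (borel :: ('a::euclidean_space \<times> real) measure)"
  shows "relabel I s \<in> measurable (PiM I N) (PiM I N)"
proof -
  have [measurable]: "fst \<in> borel_measurable (borel :: ('a \<times> real) measure)"
    by (simp_all add: borel_prod[symmetric])
  note assms[measurable_cong]
  show ?thesis
    unfolding relabel_def
  proof (rule measurable_restrict)
    fix i assume [measurable]: "i \<in> I"
    have "(\<lambda>z. (fst (z i), s i)) \<in> measurable (PiM I N) (borel \<Otimes>\<^sub>M borel)"
      by measurable
    then show "(\<lambda>z. (fst (z i), s i)) \<in> measurable (PiM I N) (N i)"
      by (simp add: borel_prod measurable_cong_sets[OF refl assms])
  qed
qed

text \<open>Induction over the coordinates with Tonelli: each coordinate contributes one factor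
  \<open>c\<close> and a sum over its two labels, and the sums combine into one over all sign
  vectors.\<close>

lemma nn_integral_PiM_relabel_le:
  fixes N :: "'i \<Rightarrow> ('a::euclidean_space \<times> real) measure" and c :: ennreal
  assumes prob: "\<And>i. prob_space (N i)"
    and sets: "\<And>i. sets (N i) = sets borel"
    and le: "\<And>i h. i \<in> I \<Longrightarrow> h \<in> borel_measurable borel \<Longrightarrow>
      (\<integral>\<^sup>+z. h z \<partial>N i) \<le> c * (\<Sum>t\<in>{-1, 1}. \<integral>\<^sup>+z. h (fst z, t) \<partial>N i)"
    and "finite I"
    and g: "g \<in> borel_measurable (PiM I N)"
  shows "(\<integral>\<^sup>+z. g z \<partial>PiM I N)
    \<le> c ^ card I * (\<Sum>s\<in>I \<rightarrow>\<^sub>E {-1, 1}. \<integral>\<^sup>+z. g (relabel I s z) \<partial>PiM I N)"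
  using \<open>finite I\<close> le g
proof (induction I arbitrary: g rule: finite_induct)
  case empty
  show ?case by (simp add: relabel_def PiM_empty nn_integral_count_space_finite restrict_def)
next
  case (insert i I)
  interpret product_sigma_finite N
    using prob by (auto simp: product_sigma_finite_def prob_space_imp_sigma_finite)
  interpret Ni: prob_space "N i" by (rule prob)
  note sets[measurable_cong] and insert.prems(2)[measurable]
  have [measurable]: "fst \<in> borel_measurable (borel :: ('a \<times> real) measure)"
    by (simp_all add: borel_prod[symmetric])
  have pair[measurable]: "(\<lambda>y. (fst y, t)) \<in> measurable (N i) (N i)" for t
  proof -
    have "(\<lambda>y. (fst y, t)) \<in> measurable (N i) (borel \<Otimes>\<^sub>M borel)" by measurable
    then show ?thesis by (simp add: borel_prod measurable_cong_sets[OF refl sets])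
  qed
  \<comment> \<open>The coordinate \<open>i\<close> is integrated out after its label has been
    overwritten by \<open>t\<close>; the induction hypothesis is applied to this function of the
    remaining coordinates.\<close>
  define G where "G t x = (\<integral>\<^sup>+y. g (x(i := (fst y, t))) \<partial>N i)" for t x
  have G[measurable]: "G t \<in> borel_measurable (PiM I N)" for t
    unfolding G_def by measurable
  have upd: "(\<lambda>y. g (x(i := y))) \<in> borel_measurable (N i)" if "x \<in> space (PiM I N)" for x
    using that by measurable
  have "(\<integral>\<^sup>+z. g z \<partial>PiM (insert i I) N) = (\<integral>\<^sup>+x. \<integral>\<^sup>+y. g (x(i := y)) \<partial>N i \<partial>PiM I N)"
    using insert by (intro product_nn_integral_insert) auto
  also have "\<dots> \<le> (\<integral>\<^sup>+x. c * (\<Sum>t\<in>{-1, 1}. G t x) \<partial>PiM I N)"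
    unfolding G_def using upd
    by (intro nn_integral_mono insert.prems(1)) (auto simp: measurable_cong_sets[OF sets refl])
  also have "\<dots> = c * (\<Sum>t\<in>{-1, 1}. \<integral>\<^sup>+x. G t x \<partial>PiM I N)"
    by (simp add: nn_integral_cmult nn_integral_add)
  also have "\<dots> \<le> c * (\<Sum>t\<in>{-1, 1}. c ^ card I * (\<Sum>s\<in>I \<rightarrow>\<^sub>E {-1, 1}. \<integral>\<^sup>+x. G t (relabel I s x) \<partial>PiM I N))"
    using insert.prems(1) by (intro mult_left_mono sum_mono insert.IH G) auto
  also have "\<dots> = c ^ card (insert i I) *
      (\<Sum>(t, s)\<in>{-1, 1} \<times> (I \<rightarrow>\<^sub>E {-1, 1}). \<integral>\<^sup>+x. G t (relabel I s x) \<partial>PiM I N)"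
    unfolding sum.cartesian_product[symmetric] card_insert_disjoint[OF insert.hyps] power_Suc
    by (simp only: sum_distrib_left[symmetric] mult.assoc)
  \<comment> \<open>Tonelli is read backwards: overwriting label \<open>i\<close> by
    \<open>t\<close> and the others by \<open>s\<close> is a single relabelling by
    \<open>s(i := t)\<close>.\<close>
  also have "(\<Sum>(t, s)\<in>{-1, 1} \<times> (I \<rightarrow>\<^sub>E {-1, 1}). \<integral>\<^sup>+x. G t (relabel I s x) \<partial>PiM I N)
      = (\<Sum>(t, s)\<in>{-1, 1} \<times> (I \<rightarrow>\<^sub>E {-1, 1}).
          \<integral>\<^sup>+z. g (relabel (insert i I) (s(i := t)) z) \<partial>PiM (insert i I) N)"
  proof (rule sum.cong[OF refl], clarify)
    fix t :: real and s :: "'i \<Rightarrow> real"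
    have "(relabel I s x)(i := (fst y, t)) = relabel (insert i I) (s(i := t)) (x(i := y))"
      for x :: "'i \<Rightarrow> 'a \<times> real" and y
      using insert.hyps by (auto simp: relabel_def fun_eq_iff)
    then show "(\<integral>\<^sup>+x. G t (relabel I s x) \<partial>PiM I N)
        = (\<integral>\<^sup>+z. g (relabel (insert i I) (s(i := t)) z) \<partial>PiM (insert i I) N)"
      using insert.hyps measurable_compose[OF measurable_relabel[OF sets] insert.prems(2)]
      by (simp add: G_def product_nn_integral_insert)
  qed
  also have "\<dots> = (\<Sum>s\<in>insert i I \<rightarrow>\<^sub>E {-1, 1}.
      \<integral>\<^sup>+z. g (relabel (insert i I) s z) \<partial>PiM (insert i I) N)"
    unfolding PiE_insert_eq
    using insert.hyps
    by (subst sum.reindex[OF inj_combinator]) (simp_all add: case_prod_beta')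
  finally show ?case .
qed

section \<open>Separability bound for independent labelled features\<close>

text \<open>Passing from the actual labels to the sum over all sign vectors costs the factor
  \<open>c ^ card I\<close>. The integrand then counts the separable sign vectors of the given
  features, which Cover's bound controls pointwise. The feature space is left general so that the
  lifted features are covered too.\<close>

lemma (in prob_space) prob_separable_le:
  fixes W :: "'i \<Rightarrow> 'a \<Rightarrow> 'b::euclidean_space" and y :: "'i \<Rightarrow> 'a \<Rightarrow> real"
  assumes I: "finite I" "I \<noteq> {}" and c: "c \<ge> 0"
    and indep: "indep_vars (\<lambda>_. borel) (\<lambda>i \<omega>. (W i \<omega>, y i \<omega>)) I"
    and labels: "\<And>i \<omega>. i \<in> I \<Longrightarrow> \<omega> \<in> space M \<Longrightarrow> y i \<omega> \<in> {-1, 1}"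
    and le: "\<And>i B t. i \<in> I \<Longrightarrow> B \<in> sets borel \<Longrightarrow> t \<in> {-1, 1} \<Longrightarrow>
      prob {\<omega> \<in> space M. W i \<omega> \<in> B \<and> y i \<omega> = t} \<le> c * prob {\<omega> \<in> space M. W i \<omega> \<in> B}"
  shows "prob {\<omega> \<in> space M. \<exists>\<beta>. \<forall>i\<in>I. y i \<omega> * (W i \<omega> \<bullet> \<beta>) > 0}
    \<le> 2 * c ^ card I * (\<Sum>j<DIM('b). real ((card I - 1) choose j))"
proof -
  define X where "X i \<omega> = (W i \<omega>, y i \<omega>)" for i \<omega>
  \<comment> \<open>Off \<open>I\<close> a point mass is the default value, so that
    \<open>N i\<close> is a probability measure for every index, as the product integration lemma
    demands.\<close>
  define N where "N i = (if i \<in> I then distr M borel (X i) else return borel undefined)" for i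
  have X: "random_variable borel (X i)" if "i \<in> I" for i
    using indep that unfolding indep_vars_def X_def by auto
  have setsN: "sets (N i) = sets borel" for i
    by (simp add: N_def)
  have probN: "prob_space (N i)" for i
    unfolding N_def using prob_space_distr[OF X] by (simp add: prob_space_return)
  have emN: "emeasure (N i) (B \<times> T) = prob {\<omega> \<in> space M. W i \<omega> \<in> B \<and> y i \<omega> \<in> T}"
    if "i \<in> I" "B \<in> sets borel" "T \<in> sets borel" for i B T
  proof -
    have "B \<times> T \<in> sets borel"
      using that by (simp add: borel_prod[symmetric])
    then have "emeasure (N i) (B \<times> T) = emeasure M (X i -` (B \<times> T) \<inter> space M)"
      using that X by (simp add: N_def emeasure_distr)
    also have "X i -` (B \<times> T) \<inter> space M = {\<omega> \<in> space M. W i \<omega> \<in> B \<and> y i \<omega> \<in> T}"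
      by (auto simp: X_def)
    finally show ?thesis by (simp add: emeasure_eq_measure)
  qed
  have labN: "AE z in N i. snd z \<in> {-1, 1}" if "i \<in> I" for i
  proof -
    have "{z :: 'b \<times> real. snd z \<in> {-1, 1}} = UNIV \<times> {-1, 1}"
      by auto
    then have "{z :: 'b \<times> real. snd z \<in> {-1, 1}} \<in> sets borel"
      by (simp add: borel_prod[symmetric])
    moreover have Ni: "N i = distr M borel (X i)"
      using that by (simp add: N_def)
    ultimately show ?thesis
      using X[OF that] labels[OF that] unfolding Ni by (subst AE_distr_iff) (simp_all add: X_def)
  qed
  have step: "(\<integral>\<^sup>+z. h z \<partial>N i) \<le> ennreal c * (\<Sum>t\<in>{-1, 1}. \<integral>\<^sup>+z. h (fst z, t) \<partial>N i)"
    if "i \<in> I" "h \<in> borel_measurable borel" for i h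
  proof (rule nn_integral_relabel_le[OF setsN labN[OF that(1)] _ that(2)])
    fix B :: "'b set" and t :: real assume B: "B \<in> sets borel" and t: "t \<in> {-1, 1}"
    show "emeasure (N i) (B \<times> {t}) \<le> ennreal c * emeasure (N i) (B \<times> UNIV)"
      using le[OF that(1) B t] c
      by (simp add: emN[OF that(1) B] ennreal_mult[symmetric])
  qed
  let ?P = "PiM I N"
  define S where "S = {z \<in> space ?P. \<exists>\<beta>. \<forall>i\<in>I. snd (z i) * (fst (z i) \<bullet> \<beta>) > 0}"
  have spP: "space ?P = I \<rightarrow>\<^sub>E UNIV"
    using sets_eq_imp_space_eq[OF setsN] by (simp add: space_PiM)
  \<comment> \<open>This is where independence enters: the joint law of the sample is the product of
    its marginals.\<close>
  have distrP: "distr M (PiM I (\<lambda>_. borel)) (\<lambda>\<omega>. \<lambda>i\<in>I. X i \<omega>) = ?P"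
    using indep_vars_iff_distr_eq_PiM'[where I = I and M' = "\<lambda>_. borel" and X = X] indep X I(2)
    by (simp add: X_def[abs_def] N_def[abs_def] cong: PiM_cong)
  have S: "S \<in> sets ?P"
  proof -
    \<comment> \<open>The union over all \<open>\<beta>\<close> is uncountable. For finite
      \<open>I\<close> the strict inequalities cut out an open set of weight vectors, so a countable
      dense set of candidates suffices.\<close>
    obtain D :: "'b set" where D: "countable D" "\<And>U. open U \<Longrightarrow> U \<noteq> {} \<Longrightarrow> \<exists>d\<in>D. d \<in> U"
      using countable_dense_setE by blast
    have dense: "(\<exists>\<beta>. \<forall>i\<in>I. snd (z i) * (fst (z i) \<bullet> \<beta>) > 0)
        \<longleftrightarrow> (\<exists>\<beta>\<in>D. \<forall>i\<in>I. snd (z i) * (fst (z i) \<bullet> \<beta>) > 0)" for z :: "'i \<Rightarrow> 'b \<times> real"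
    proof -
      have "open (\<Inter>i\<in>I. {\<beta>. snd (z i) * (fst (z i) \<bullet> \<beta>) > 0})"
        using I(1) by (intro open_INT ballI open_Collect_less continuous_intros)
      from D(2)[OF this] show ?thesis by auto
    qed
    note setsN[measurable_cong]
    have [measurable]: "fst \<in> borel_measurable (borel :: ('b \<times> real) measure)"
        "snd \<in> borel_measurable (borel :: ('b \<times> real) measure)"
      by (simp_all add: borel_prod[symmetric])
    have "{z \<in> space ?P. \<forall>i\<in>I. snd (z i) * (fst (z i) \<bullet> \<beta>) > 0} \<in> sets ?P" for \<beta>
      using I(1) by measurable
    then have "(\<Union>\<beta>\<in>D. {z \<in> space ?P. \<forall>i\<in>I. snd (z i) * (fst (z i) \<bullet> \<beta>) > 0}) \<in> sets ?P"
      using D(1) by (intro sets.countable_UN') auto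
    also have "(\<Union>\<beta>\<in>D. {z \<in> space ?P. \<forall>i\<in>I. snd (z i) * (fst (z i) \<bullet> \<beta>) > 0}) = S"
      unfolding S_def dense by auto
    finally show ?thesis .
  qed
  let ?K = "2 * (\<Sum>j<DIM('b). (card I - 1) choose j)"
  \<comment> \<open>The relabelled configuration lies in \<open>S\<close> exactly when
    \<open>s\<close> is a sign pattern of the features of \<open>z\<close>, so the sum is the number
    of such patterns.\<close>
  have count: "(\<Sum>s\<in>I \<rightarrow>\<^sub>E {-1, 1}. indicator S (relabel I s z)) \<le> (of_nat ?K :: ennreal)" for z
  proof -
    have "(\<Sum>s\<in>I \<rightarrow>\<^sub>E {-1, 1}. indicator S (relabel I s z))
        = (\<Sum>s\<in>I \<rightarrow>\<^sub>E {-1, 1}. indicator (sign_patterns I (fst \<circ> z) UNIV) s :: ennreal)"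
      by (intro sum.cong) (auto simp: S_def spP sign_patterns_def relabel_def split: split_indicator)
    also have "\<dots> = (\<Sum>s\<in>sign_patterns I (fst \<circ> z) UNIV. 1)"
      using I(1)
      by (intro sum.mono_neutral_cong_right) (auto simp: finite_PiE sign_patterns_def indicator_def)
    also have "\<dots> = of_nat (card (sign_patterns I (fst \<circ> z) UNIV))"
      by simp
    also have "\<dots> \<le> of_nat ?K"
      using card_sign_patterns_le[OF I subspace_UNIV, of "fst \<circ> z"] by (subst of_nat_le_iff) simp
    finally show ?thesis .
  qed
  have "emeasure M {\<omega> \<in> space M. \<exists>\<beta>. \<forall>i\<in>I. y i \<omega> * (W i \<omega> \<bullet> \<beta>) > 0}
      = emeasure M ((\<lambda>\<omega>. \<lambda>i\<in>I. X i \<omega>) -` S \<inter> space M)"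
    by (rule arg_cong[where f = "emeasure M"]) (auto simp: S_def spP X_def)
  also have "\<dots> = emeasure ?P S"
    using S X unfolding distrP[symmetric]
    by (subst emeasure_distr) (auto intro!: measurable_restrict)
  also have "\<dots> = (\<integral>\<^sup>+z. indicator S z \<partial>?P)"
    using S by simp
  also have "\<dots> \<le> ennreal c ^ card I * (\<Sum>s\<in>I \<rightarrow>\<^sub>E {-1, 1}. \<integral>\<^sup>+z. indicator S (relabel I s z) \<partial>?P)"
    using S by (intro nn_integral_PiM_relabel_le probN setsN step I(1)) auto
  also have "(\<Sum>s\<in>I \<rightarrow>\<^sub>E {-1, 1}. \<integral>\<^sup>+z. indicator S (relabel I s z) \<partial>?P)
      = (\<integral>\<^sup>+z. (\<Sum>s\<in>I \<rightarrow>\<^sub>E {-1, 1}. indicator S (relabel I s z)) \<partial>?P)"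
    using S by (intro nn_integral_sum[symmetric] measurable_compose[OF measurable_relabel[OF setsN]]) auto
  also have "\<dots> \<le> (\<integral>\<^sup>+z. of_nat ?K \<partial>?P)"
    by (intro nn_integral_mono count)
  also have "\<dots> = of_nat ?K"
    using prob_space.emeasure_space_1[OF prob_space_PiM[of I N, OF probN]] by simp
  finally have "emeasure M {\<omega> \<in> space M. \<exists>\<beta>. \<forall>i\<in>I. y i \<omega> * (W i \<omega> \<bullet> \<beta>) > 0}
      \<le> ennreal c ^ card I * of_nat ?K"
    by (simp add: mult_left_mono)
  also have "\<dots> = ennreal (c ^ card I * real ?K)"
    using c by (simp only: ennreal_power ennreal_of_nat_eq_real_of_nat ennreal_mult zero_le_power of_nat_0_le_iff)
  finally show ?thesis
    using c by (simp add: emeasure_eq_measure mult_ac sum_nonneg)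
qed

section \<open>Separability with and without intercept\<close>

lemma (in gaussian_labelled_sample) random_variables:
  assumes "j \<in> {1..n}"
  shows "random_variable borel (x j)" "random_variable borel (y j)"
proof -
  have "(\<lambda>\<omega>. (x j \<omega>, y j \<omega>)) \<in> measurable M (borel \<Otimes>\<^sub>M borel)"
    using independent assms unfolding indep_vars_def borel_prod by auto
  from measurable_compose[OF this measurable_fst] measurable_compose[OF this measurable_snd]
  show "random_variable borel (x j)" "random_variable borel (y j)" by simp_all
qed

text \<open>A Borel feature map applied to each \<open>x j\<close> preserves independence. The upper
  bound handles the label 1; the lower bound, by complement, gives the same upper bound
  \<open>c\<close> for the label -1.\<close>

lemma (in gaussian_labelled_sample) prob_separable_feature_le:
  fixes \<phi> :: "real ^ 'p \<Rightarrow> 'c::euclidean_space"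
  assumes n: "n > 0" and c: "c \<ge> 0" and \<phi>: "\<phi> \<in> borel_measurable borel"
    and bounds: "\<And>j B. j \<in> {1..n} \<Longrightarrow> B \<in> sets borel \<Longrightarrow>
      prob {\<omega> \<in> space M. x j \<omega> \<in> B \<and> y j \<omega> = 1}
        \<in> {(1 - c) * prob {\<omega> \<in> space M. x j \<omega> \<in> B} .. c * prob {\<omega> \<in> space M. x j \<omega> \<in> B}}"
  shows "prob {\<omega> \<in> space M. \<exists>\<beta>. \<forall>j\<in>{1..n}. y j \<omega> * (\<phi> (x j \<omega>) \<bullet> \<beta>) > 0}
    \<le> 2 * c ^ n * (\<Sum>j<DIM('c). real ((n - 1) choose j))"
proof -
  have fm: "(\<lambda>z. (\<phi> (fst z), snd z :: real)) \<in> borel_measurable borel"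
    using \<phi> by (simp add: borel_prod[symmetric])
  have "indep_vars (\<lambda>_. borel) (\<lambda>j \<omega>. (\<phi> (x j \<omega>), y j \<omega>)) {1..n}"
    using indep_vars_compose2[OF independent, of "\<lambda>_ z. (\<phi> (fst z), snd z)"] fm by simp
  moreover have "prob {\<omega> \<in> space M. \<phi> (x j \<omega>) \<in> B \<and> y j \<omega> = t} \<le> c * prob {\<omega> \<in> space M. \<phi> (x j \<omega>) \<in> B}"
    if j: "j \<in> {1..n}" and B: "B \<in> sets borel" and t: "t \<in> {-1, 1}" for j B t
  proof -
    note [measurable] = random_variables[OF j] \<phi> B
    let ?A = "{\<omega> \<in> space M. \<phi> (x j \<omega>) \<in> B}" and ?E = "\<lambda>t. {\<omega> \<in> space M. \<phi> (x j \<omega>) \<in> B \<and> y j \<omega> = t}"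
    have "\<phi> -` B \<in> sets borel"
      using measurable_sets[OF \<phi> B] by simp
    from bounds[OF j this] have *: "prob (?E 1) \<in> {(1 - c) * prob ?A .. c * prob ?A}" by simp
    have "prob (?E (-1)) = prob (?A - ?E 1)"
      using labels[OF j] by (intro arg_cong[where f = prob]) auto
    also have "\<dots> = prob ?A - prob (?E 1)"
      by (intro finite_measure_Diff) auto
    finally show ?thesis
      using * t by (auto simp: algebra_simps)
  qed
  ultimately show ?thesis
    using prob_separable_le[of "{1..n}" c "\<lambda>j \<omega>. \<phi> (x j \<omega>)" y] n c labels by simp
qed

text \<open>The feature map is the identity in the first case and the lifting to one more dimension
  in the second.\<close>

lemma (in gaussian_labelled_sample) separability_probs_le:
  assumes n: "n > 0" and c: "c \<ge> 0"
    and bounds: "\<And>j B. j \<in> {1..n} \<Longrightarrow> B \<in> sets borel \<Longrightarrow>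
      prob {\<omega> \<in> space M. x j \<omega> \<in> B \<and> y j \<omega> = 1}
        \<in> {(1 - c) * prob {\<omega> \<in> space M. x j \<omega> \<in> B} .. c * prob {\<omega> \<in> space M. x j \<omega> \<in> B}}"
  shows "separability_prob M n x y \<le> 2 * c ^ n * (\<Sum>j = 0..CARD('p) - 1. real ((n - 1) choose j))"
    and "separability_prob_intercept M n x y \<le> 2 * c ^ n * (\<Sum>j = 0..CARD('p). real ((n - 1) choose j))"
proof -
  \<comment> \<open>The truncated subtraction is harmless because \<open>CARD('p)\<close> is
    positive.\<close>
  have "{..<CARD('p)} = {0..CARD('p) - 1}"
    by (cases "CARD('p)") auto
  moreover have "separability_prob M n x y \<le> 2 * c ^ n * (\<Sum>j<DIM(real ^ 'p). real ((n - 1) choose j))"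
    unfolding separability_prob_def
    by (rule prob_separable_feature_le[OF n c measurable_ident bounds, unfolded id_def])
  ultimately show "separability_prob M n x y \<le> 2 * c ^ n * (\<Sum>j = 0..CARD('p) - 1. real ((n - 1) choose j))"
    by simp
  have \<phi>: "(\<lambda>v :: real ^ 'p. (1 :: real, v)) \<in> borel_measurable borel"
    by (intro borel_measurable_continuous_onI continuous_intros)
  have "{..<DIM(real \<times> (real ^ 'p))} = {0..CARD('p)}"
    by auto
  \<comment> \<open>The first component of the weight vector is the intercept, since it is
    multiplied by the constant 1.\<close>
  moreover have "separability_prob_intercept M n x y
      = prob {\<omega> \<in> space M. \<exists>\<beta>. \<forall>j\<in>{1..n}. y j \<omega> * ((1 :: real, x j \<omega>) \<bullet> \<beta>) > 0}"
    unfolding separability_prob_intercept_def by (simp add: split_paired_Ex inner_real_def)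
  ultimately show "separability_prob_intercept M n x y \<le> 2 * c ^ n * (\<Sum>j = 0..CARD('p). real ((n - 1) choose j))"
    using prob_separable_feature_le[OF n c \<phi> bounds] by metis
qed

section \<open>Label probabilities in the two models\<close>

text \<open>The conditional probability of the label 1 takes only the values \<open>\<delta>\<close>
  and \<open>1 - \<delta>\<close>, and it is integrated over an event determined by
  \<open>x j\<close>.\<close>

lemma (in sign_flip_model) prob_label_bounds:
  assumes \<delta>: "\<delta> \<ge> 1 / 2" and j: "j \<in> {1..n}" and B: "B \<in> sets borel"
  shows "prob {\<omega> \<in> space M. x j \<omega> \<in> B \<and> y j \<omega> = 1}
    \<in> {(1 - \<delta>) * prob {\<omega> \<in> space M. x j \<omega> \<in> B} .. \<delta> * prob {\<omega> \<in> space M. x j \<omega> \<in> B}}"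
proof -
  note [measurable] = random_variables[OF j] B
  define F where "F = vimage_algebra (space M) (x j) borel"
  define A where "A = {\<omega> \<in> space M. x j \<omega> \<in> B}"
  define Y where "Y = {\<omega> \<in> space M. y j \<omega> = 1}"
  define r where "r = real_cond_exp M F (indicat_real Y)"
  have "sets F \<subseteq> sets M"
    unfolding F_def sets_vimage_algebra using measurable_sets[OF random_variables(1)[OF j]]
    by (auto intro!: sets.sigma_sets_subset)
  then have "subalgebra M F"
    by (simp add: subalgebra_def F_def)
  then interpret finite_measure_subalgebra M F
    by unfold_locales
  have AF: "A \<in> sets F"
    unfolding F_def A_def using in_vimage_algebra[OF B, of "x j" "space M"]
    by (simp add: vimage_def Int_def conj_commute)
  have [measurable]: "A \<in> sets M" "Y \<in> sets M"
    unfolding A_def Y_def by measurable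
  have int: "integrable M (indicat_real Y)"
    by (simp add: emeasure_eq_measure)
  have intr: "integrable M r"
    unfolding r_def by (rule real_cond_exp_int(1)[OF int])
  have rA: "integrable M (\<lambda>\<omega>. indicator A \<omega> * r \<omega>)"
    using integrable_mult_indicator[OF \<open>A \<in> sets M\<close> intr] by simp
  have cA: "integrable M (\<lambda>\<omega>. indicator A \<omega> * c)" for c :: real
    by (simp add: emeasure_eq_measure)
  \<comment> \<open>Both possible values lie in this interval because \<open>\<delta>\<close> is at
    least 1/2.\<close>
  have r: "AE \<omega> in M. r \<omega> \<in> {1 - \<delta>..\<delta>}"
    using sign_flip[OF j] unfolding r_def F_def Y_def
    by eventually_elim (use \<delta> in auto)
  have "prob (A \<inter> Y) = (\<integral>\<omega>. indicator A \<omega> * indicator Y \<omega> \<partial>M)"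
    by (simp add: indicator_inter_arith[symmetric])
  \<comment> \<open>The defining property of conditional expectation, available since
    \<open>A\<close> belongs to the algebra generated by \<open>x j\<close>.\<close>
  also have "\<dots> = (\<integral>\<omega>. indicator A \<omega> * r \<omega> \<partial>M)"
    using real_cond_exp_intA[OF int AF] by (simp add: set_lebesgue_integral_def r_def)
  finally have eq: "prob (A \<inter> Y) = (\<integral>\<omega>. indicator A \<omega> * r \<omega> \<partial>M)" .
  have "(\<integral>\<omega>. indicator A \<omega> * (1 - \<delta>) \<partial>M) \<le> (\<integral>\<omega>. indicator A \<omega> * r \<omega> \<partial>M)"
    by (intro integral_mono_AE cA rA) (use r in \<open>eventually_elim; auto split: split_indicator\<close>)
  moreover have "(\<integral>\<omega>. indicator A \<omega> * r \<omega> \<partial>M) \<le> (\<integral>\<omega>. indicator A \<omega> * \<delta> \<partial>M)"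
    by (intro integral_mono_AE cA rA) (use r in \<open>eventually_elim; auto split: split_indicator\<close>)
  ultimately have "prob (A \<inter> Y) \<in> {(1 - \<delta>) * prob A .. \<delta> * prob A}"
    unfolding eq by (simp add: mult.commute)
  moreover have "A \<inter> Y = {\<omega> \<in> space M. x j \<omega> \<in> B \<and> y j \<omega> = 1}"
    by (auto simp: A_def Y_def)
  ultimately show ?thesis
    by (simp add: A_def)
qed

lemma (in signalless_imbalanced_model) prob_label:
  assumes j: "j \<in> {1..n}" and B: "B \<in> sets borel"
  shows "prob {\<omega> \<in> space M. x j \<omega> \<in> B \<and> y j \<omega> = 1} = b * prob {\<omega> \<in> space M. x j \<omega> \<in> B}"
proof -
  let ?A = "x j -` B \<inter> space M" and ?Y = "y j -` {1} \<inter> space M"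
  have "prob (?A \<inter> ?Y) = prob ?A * prob ?Y"
    by (rule indep_setD[OF label_indep[OF j]]) (auto intro!: in_vimage_algebra B)
  moreover have "?Y = {\<omega> \<in> space M. y j \<omega> = 1}" "?A = {\<omega> \<in> space M. x j \<omega> \<in> B}"
    "?A \<inter> ?Y = {\<omega> \<in> space M. x j \<omega> \<in> B \<and> y j \<omega> = 1}"
    by auto
  ultimately show ?thesis
    using label_prob[OF j] by (metis mult.commute)
qed

theorem proposition3:
  fixes M :: "'w measure" and n :: nat
    and x :: "nat \<Rightarrow> 'w \<Rightarrow> real ^ 'p" and y :: "nat \<Rightarrow> 'w \<Rightarrow> real"
  assumes "CARD('p) < n"
  shows "(\<forall>\<delta> \<beta>0 \<beta>. sign_flip_model M n x y \<delta> \<beta>0 \<beta> \<and> \<delta> \<ge> 1 / 2 \<longrightarrow>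
            separability_prob M n x y
              \<le> 2 * \<delta> ^ n * (\<Sum>j = 0..CARD('p) - 1. real ((n - 1) choose j)) \<and>
            separability_prob_intercept M n x y
              \<le> 2 * \<delta> ^ n * (\<Sum>j = 0..CARD('p). real ((n - 1) choose j))) \<and>
         (\<forall>b. signalless_imbalanced_model M n x y b \<and> b \<ge> 1 / 2 \<longrightarrow>
            separability_prob_intercept M n x y
              \<le> 2 * b ^ n * (\<Sum>j = 0..CARD('p). real ((n - 1) choose j)))"
proof -
  \<comment> \<open>Positivity makes \<open>{1..n}\<close> nonempty, as the counting bound
    requires.\<close>
  have n: "n > 0" using assms by simp
  show ?thesis
  proof (intro conjI allI impI; elim conjE)
    fix \<delta> \<beta>0 :: real and \<beta> :: "real ^ 'p"
    assume "sign_flip_model M n x y \<delta> \<beta>0 \<beta>" and \<delta>: "\<delta> \<ge> 1 / 2"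
    then interpret sign_flip_model M n x y \<delta> \<beta>0 \<beta> by simp
    have "\<delta> \<ge> 0" using \<delta> by simp
    note le = separability_probs_le[OF n this prob_label_bounds[OF \<delta>]]
    show "separability_prob M n x y \<le> 2 * \<delta> ^ n * (\<Sum>j = 0..CARD('p) - 1. real ((n - 1) choose j))"
      by (rule le(1))
    show "separability_prob_intercept M n x y \<le> 2 * \<delta> ^ n * (\<Sum>j = 0..CARD('p). real ((n - 1) choose j))"
      by (rule le(2))
  next
    fix b :: real
    assume "signalless_imbalanced_model M n x y b" and b: "b \<ge> 1 / 2"
    then interpret signalless_imbalanced_model M n x y b by simp
    \<comment> \<open>The conditional probability is exactly \<open>b\<close>, which lies between
      \<open>1 - b\<close> and \<open>b\<close> because \<open>b\<close> is at least 1/2.\<close>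
    have bounds: "prob {\<omega> \<in> space M. x j \<omega> \<in> B \<and> y j \<omega> = 1}
        \<in> {(1 - b) * prob {\<omega> \<in> space M. x j \<omega> \<in> B} .. b * prob {\<omega> \<in> space M. x j \<omega> \<in> B}}"
      if "j \<in> {1..n}" "B \<in> sets borel" for j B
      using b by (auto simp: prob_label[OF that] intro!: mult_right_mono)
    have "b \<ge> 0" using b by simp
    show "separability_prob_intercept M n x y \<le> 2 * b ^ n * (\<Sum>j = 0..CARD('p). real ((n - 1) choose j))"
      by (rule separability_probs_le(2)[OF n \<open>b \<ge> 0\<close> bounds])
  qed
qed

end
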